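(* Let $T=(T_1,\ldots,T_d)$ be a commuting tuple of bounded linear operators on a complex separable Hilbert space $\mathcal H$. Suppose that $T$ is weakly $\mathcal U(d)$-homogeneous and, for each $u\in\mathcal U(d)$, let $\Gamma(u)$ be a bounded invertible operator on $\mathcal H$ such that $$\Gamma(u)\,T_j=(u\cdot T)_j\,\Gamma(u)\qquad\text{for all } j=1,\ldots,d \text{ and } u\in\mathcal U(d).$$ If $u\mapsto \Gamma(u)$ is a strongly continuous representation of $\mathcal U(d)$, then $T$ is similar to a $\mathcal U(d)$-homogeneous tuple on $\mathcal H$.
   Context: Here $d$ is a positive integer and $\mathcal U(d)$ is the compact group of $d\times d$ complex unitary matrices. For $u=(u_{jk})\in\mathcal U(d)$ and a $d$-tuple $T=(T_1,\ldots,T_d)$ of operators, $u\cdot T$ is the $d$-tuple with $(u\cdot T)_j=\sum_{k=1}^d u_{jk}T_k$. A commuting $d$-tuple $T$ of bounded linear operators on $\mathcal H$ is $\mathcal U(d)$-homogeneous if for every $u\in\mathcal U(d)$ the tuple $u\cdot T$ is unitarily equivalent to $T$, that is, there is a unitary $V$ on $\mathcal H$ with $VT_j=(u\cdot T)_jV$ for $j=1,\ldots,d$; it is weakly $\mathcal U(d)$-homogeneous if for every $u\in\mathcal U(d)$ there is a bounded invertible operator $\Gamma(u)$ on $\mathcal H$ with $\Gamma(u)T_j=(u\cdot T)_j\Gamma(u)$ for $j=1,\ldots,d$. Two $d$-tuples $T$ on $\mathcal H$ and $T'$ on $\mathcal H'$ are similar if there is a bounded invertible operator $S:\mathcal H\to\mathcal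 H'$ with $ST_j=T'_jS$ for all $j=1,\ldots,d$. A strongly continuous representation of $\mathcal U(d)$ on $\mathcal H$ is a group homomorphism $\pi$ from $\mathcal U(d)$ into the group of bounded invertible operators on $\mathcal H$ such that $u\mapsto\pi(u)x$ is norm continuous for each $x\in\mathcal H$. *)

theory Defs
  imports "HOL-Analysis.Analysis"
begin

section \<open>Complex Hilbert spaces\<close>

text \<open>
  A complex inner product space is a real inner product space that also carries a complex
  scalar multiplication extending the real one and a sesquilinear form (linear in the first
  argument) whose real part is the real inner product. Norm and topology are therefore the
  ones of \<^class>\<open>real_inner\<close>, and positive definiteness is inherited from there.
\<close>

class complex_inner = real_inner +
  fixes scaleC :: "complex \<Rightarrow> 'a \<Rightarrow> 'a"  (infixr \<open>*\<^sub>C\<close> 75)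
    and cinner :: "'a \<Rightarrow> 'a \<Rightarrow> complex"
  assumes scaleC_add_right: "a *\<^sub>C (x + y) = a *\<^sub>C x + a *\<^sub>C y"
    and scaleC_add_left: "(a + b) *\<^sub>C x = a *\<^sub>C x + b *\<^sub>C x"
    and scaleC_scaleC: "a *\<^sub>C b *\<^sub>C x = (a * b) *\<^sub>C x"
    and scaleC_of_real: "complex_of_real r *\<^sub>C x = r *\<^sub>R x"
    and cinner_commute: "cinner x y = cnj (cinner y x)"
    and cinner_add_left: "cinner (x + y) z = cinner x z + cinner y z"
    and cinner_scaleC_left: "cinner (a *\<^sub>C x) y = a * cinner x y"
    and Re_cinner: "Re (cinner x y) = inner x y"

class complex_hilbert = complex_inner + complete_space

instantiation complex :: complex_hilbert
begin

definition scaleC_complex :: "complex \<Rightarrow> complex \<Rightarrow> complex"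
  where "scaleC_complex a x = a * x"

definition cinner_complex :: "complex \<Rightarrow> complex \<Rightarrow> complex"
  where "cinner_complex x y = x * cnj y"

instance
  by standard
    (simp_all add: scaleC_complex_def cinner_complex_def algebra_simps scaleR_conv_of_real
      inner_complex_def)

end


section \<open>Operators and tuples of operators\<close>

definition bounded_clinear :: "('h::complex_inner \<Rightarrow> 'k::complex_inner) \<Rightarrow> bool"
  where "bounded_clinear A \<longleftrightarrow> bounded_linear A \<and> (\<forall>c x. A (c *\<^sub>C x) = c *\<^sub>C A x)"

definition bounded_invertible :: "('h::complex_inner \<Rightarrow> 'k::complex_inner) \<Rightarrow> bool"
  where "bounded_invertible A \<longleftrightarrow>
    bounded_clinear A \<and> (\<exists>B. bounded_clinear B \<and> B \<circ> A = id \<and> A \<circ> B = id)"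

definition unitary_op :: "('h::complex_inner \<Rightarrow> 'k::complex_inner) \<Rightarrow> bool"
  where "unitary_op V \<longleftrightarrow>
    bounded_clinear V \<and> surj V \<and> (\<forall>x y. cinner (V x) (V y) = cinner x y)"

text \<open>
  A \<open>d\<close>-tuple is a function on a finite index type \<open>'d\<close> with \<open>d = CARD('d)\<close>;
  as types are inhabited, \<open>d \<ge> 1\<close>.
\<close>

definition commuting_tuple :: "('d::finite \<Rightarrow> 'h::complex_inner \<Rightarrow> 'h) \<Rightarrow> bool"
  where "commuting_tuple T \<longleftrightarrow>
    (\<forall>j. bounded_clinear (T j)) \<and> (\<forall>i j. T i \<circ> T j = T j \<circ> T i)"

definition similar_tuples ::
    "('d::finite \<Rightarrow> 'h::complex_inner \<Rightarrow> 'h) \<Rightarrow> ('d \<Rightarrow> 'k::complex_inner \<Rightarrow> 'k) \<Rightarrow> bool"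
  where "similar_tuples T T' \<longleftrightarrow>
    (\<exists>S. bounded_invertible S \<and> (\<forall>j. S \<circ> T j = T' j \<circ> S))"

definition unitarily_equivalent ::
    "('d::finite \<Rightarrow> 'h::complex_inner \<Rightarrow> 'h) \<Rightarrow> ('d \<Rightarrow> 'k::complex_inner \<Rightarrow> 'k) \<Rightarrow> bool"
  where "unitarily_equivalent T T' \<longleftrightarrow>
    (\<exists>V. unitary_op V \<and> (\<forall>j. V \<circ> T j = T' j \<circ> V))"


section \<open>The unitary group and homogeneity\<close>

definition ctranspose :: "complex^'n^'m \<Rightarrow> complex^'m^'n"
  where "ctranspose u = (\<chi> i j. cnj (u $ j $ i))"

definition unitary_group :: "(complex^'d::finite^'d) set"
  where "unitary_group = {u. u ** ctranspose u = mat 1 \<and> ctranspose u ** u = mat 1}"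

definition act_tuple ::
    "complex^'d^'d \<Rightarrow> ('d::finite \<Rightarrow> 'h::complex_inner \<Rightarrow> 'h) \<Rightarrow> 'd \<Rightarrow> 'h \<Rightarrow> 'h"
  where "act_tuple u T j x = (\<Sum>k\<in>UNIV. (u $ j $ k) *\<^sub>C T k x)"

definition homogeneous :: "('d::finite \<Rightarrow> 'h::complex_inner \<Rightarrow> 'h) \<Rightarrow> bool"
  where "homogeneous T \<longleftrightarrow>
    commuting_tuple T \<and> (\<forall>u\<in>unitary_group. unitarily_equivalent T (act_tuple u T))"

definition weakly_homogeneous :: "('d::finite \<Rightarrow> 'h::complex_inner \<Rightarrow> 'h) \<Rightarrow> bool"
  where "weakly_homogeneous T \<longleftrightarrow>
    commuting_tuple T \<and> (\<forall>u\<in>unitary_group. similar_tuples T (act_tuple u T))"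

text \<open>
  A representation is a total function on matrices of which only the values on
  \<^const>\<open>unitary_group\<close> matter.
\<close>

definition strongly_continuous_rep ::
    "(complex^'d::finite^'d \<Rightarrow> 'h::complex_inner \<Rightarrow> 'h) \<Rightarrow> bool"
  where "strongly_continuous_rep \<pi> \<longleftrightarrow>
    (\<forall>u\<in>unitary_group. bounded_invertible (\<pi> u)) \<and>
    (\<forall>u\<in>unitary_group. \<forall>v\<in>unitary_group. \<pi> (u ** v) = \<pi> u \<circ> \<pi> v) \<and>
    (\<forall>x. continuous_on unitary_group (\<lambda>u. \<pi> u x))"

end

theory Submission
  imports Defs
begin

text \<open>
  The proof is Weyl's unitarian trick. Averaging the inner product over the group gives the form
  \<open>q x y = mean (\<lambda>u. \<langle>\<Gamma> u x, \<Gamma> u y\<rangle>)\<close>, and invariance of the mean under right translations makes every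
  \<open>\<Gamma> v\<close> an isometry of \<open>q\<close>. As strong continuity on a compact group bounds \<open>\<parallel>\<Gamma> u\<parallel>\<close> uniformly
  (\<open>uniform_boundedness\<close>), also for inverses, \<open>q\<close> is equivalent to the original inner product. Hence
  \<open>q x y = \<langle>S x, S y\<rangle>\<close> for a bounded invertible \<open>S\<close> (\<open>form_factorization\<close>), the operators
  \<open>S \<circ> \<Gamma> u \<circ> S\<inverse>\<close> are unitary, and they intertwine \<open>S \<circ> T j \<circ> S\<inverse>\<close> with its image under \<open>u\<close>, because
  the action of \<open>u\<close> on tuples is given by linear combinations and commutes with conjugation by \<open>S\<close>.

  The mean is a functional on continuous functions, constructed after von Neumann. Averages over
  finitely many right translates of a continuous function \<open>f\<close> come arbitrarily close to constants:
  averaging over a fine net cuts off a definite proportion of the oscillation, and does not spoil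
  the modulus of continuity (\<open>almost_constant_mean\<close>). The same holds for
  left translates. Since left and right averages commute, all the constants so approximated agree;
  the common value is the mean. Its linearity and invariance follow by playing the two kinds of
  averages against each other. The group enters only through compactness and a two-sided invariant
  metric, which on unitary matrices is the Frobenius distance.

  The operator \<open>S\<close> is a multiple of the positive square root of the operator representing \<open>q\<close>.
  After scaling, the latter is \<open>1 - A\<close> with \<open>0 \<le> A \<le> a < 1\<close>, and \<open>1 - B\<close> is a square root of it
  if and only if \<open>B = (A + B\<^sup>2) / 2\<close>, a fixed point equation for a contraction of a ball of
  operators of radius less than \<open>1\<close>.
\<close>

section \<open>Means on compact groups\<close>

text \<open>
  The averages of right translates over finite sets, closed under composition. With the
  multiplication reversed, these are the averages of left translates.
\<close>

inductive_set means :: "'a set \<Rightarrow> ('a \<Rightarrow> 'a \<Rightarrow> 'a) \<Rightarrow> (('a \<Rightarrow> real) \<Rightarrow> 'a \<Rightarrow> real) set"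
  for G mul where
  average: "finite A \<Longrightarrow> A \<noteq> {} \<Longrightarrow> A \<subseteq> G \<Longrightarrow>
    (\<lambda>f x. (\<Sum>a\<in>A. f (mul x a)) / real (card A)) \<in> means G mul"
| comp: "P \<in> means G mul \<Longrightarrow> Q \<in> means G mul \<Longrightarrow> (\<lambda>f. P (Q f)) \<in> means G mul"

text \<open>
  A compact group with a two-sided invariant metric. Unit and inverses are replaced by the solvability
  of \<open>x \<cdot> z = y\<close> and \<open>z \<cdot> x = y\<close>, which for a nonempty associative structure amounts to the same and
  is the form in which they enter the averaging argument.
\<close>

locale compact_metric_group =
  fixes G :: "'a::metric_space set" and mul :: "'a \<Rightarrow> 'a \<Rightarrow> 'a" (infixl "\<cdot>" 70)
  assumes mul_closed: "x \<in> G \<Longrightarrow> y \<in> G \<Longrightarrow> x \<cdot> y \<in> G"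
    and mul_assoc: "x \<in> G \<Longrightarrow> y \<in> G \<Longrightarrow> z \<in> G \<Longrightarrow> (x \<cdot> y) \<cdot> z = x \<cdot> (y \<cdot> z)"
    and left_divide: "x \<in> G \<Longrightarrow> y \<in> G \<Longrightarrow> \<exists>z\<in>G. x \<cdot> z = y"
    and right_divide: "x \<in> G \<Longrightarrow> y \<in> G \<Longrightarrow> \<exists>z\<in>G. z \<cdot> x = y"
    and dist_left: "x \<in> G \<Longrightarrow> y \<in> G \<Longrightarrow> z \<in> G \<Longrightarrow> dist (z \<cdot> x) (z \<cdot> y) = dist x y"
    and dist_right: "x \<in> G \<Longrightarrow> y \<in> G \<Longrightarrow> z \<in> G \<Longrightarrow> dist (x \<cdot> z) (y \<cdot> z) = dist x y"
    and compact: "compact G"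
    and nonempty: "G \<noteq> {}"
begin

abbreviation "right_means \<equiv> means G mul"
abbreviation "left_means \<equiv> means G (\<lambda>x y. y \<cdot> x)"

text \<open>
  The axioms are symmetric in the two sides, so each statement about right means also gives one
  about left means.
\<close>

lemma opposite: "compact_metric_group G (\<lambda>x y. y \<cdot> x)"
  by unfold_locales
    (auto simp: mul_closed mul_assoc left_divide right_divide dist_left dist_right compact nonempty)

lemma means_cong:
  assumes "P \<in> right_means" and "\<And>y. y \<in> G \<Longrightarrow> f y = g y" and "x \<in> G"
  shows "P f x = P g x"
  using assms
proof (induction arbitrary: f g x)
  case (average A)
  have "f (x \<cdot> a) = g (x \<cdot> a)" if "a \<in> A" for a
    using average that mul_closed by blast
  then show ?case by simp
qed blast

lemma means_bounds:
  assumes "P \<in> right_means" and "\<And>y. y \<in> G \<Longrightarrow> lo \<le> f y \<and> f y \<le> hi" and "x \<in> G"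
  shows "lo \<le> P f x \<and> P f x \<le> hi"
  using assms
proof (induction arbitrary: f x)
  case (average A)
  have b: "lo \<le> f (x \<cdot> a) \<and> f (x \<cdot> a) \<le> hi" if "a \<in> A" for a
    using average that mul_closed by blast
  have "card A > 0"
    using average by (simp add: card_gt_0_iff)
  moreover have "real (card A) * lo \<le> (\<Sum>a\<in>A. f (x \<cdot> a))"
    using sum_bounded_below[of A lo "\<lambda>a. f (x \<cdot> a)"] b by simp
  moreover have "(\<Sum>a\<in>A. f (x \<cdot> a)) \<le> real (card A) * hi"
    using sum_bounded_above[of A "\<lambda>a. f (x \<cdot> a)" hi] b by simp
  ultimately show ?case
    by (simp add: field_simps)
qed blast

lemma means_add:
  assumes "P \<in> right_means"
  shows "P (\<lambda>x. f x + g x) = (\<lambda>x. P f x + P g x)"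
  using assms
proof (induction arbitrary: f g)
  case (average A)
  then show ?case by (simp add: sum.distrib add_divide_distrib)
qed simp

lemma means_scale:
  assumes "P \<in> right_means"
  shows "P (\<lambda>x. c * f x) = (\<lambda>x. c * P f x)"
  using assms
proof (induction arbitrary: f)
  case (average A)
  then show ?case by (simp flip: sum_distrib_left)
qed simp

lemma means_sum:
  assumes P: "P \<in> right_means" and "finite B"
  shows "P (\<lambda>x. \<Sum>b\<in>B. F b x) = (\<lambda>x. \<Sum>b\<in>B. P (F b) x)"
  using assms(2)
proof induction
  case empty
  then show ?case using means_scale[OF P, of 0] by simp
next
  case (insert b B)
  then show ?case using means_add[OF P, of "F b" "\<lambda>x. \<Sum>b\<in>B. F b x"] by simp
qed

lemma means_translate:
  assumes "P \<in> right_means" and "b \<in> G" and "x \<in> G"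
  shows "P (\<lambda>y. f (b \<cdot> y)) x = P f (b \<cdot> x)"
  using assms
proof (induction arbitrary: f x)
  case (average A)
  have "b \<cdot> (x \<cdot> a) = (b \<cdot> x) \<cdot> a" if "a \<in> A" for a
    using average that mul_assoc by auto
  then show ?case by simp
next
  case (comp P Q)
  have "P (Q (\<lambda>y. f (b \<cdot> y))) x = P (\<lambda>y. Q f (b \<cdot> y)) x"
    by (rule means_cong[OF comp.hyps(1)]) (use comp in auto)
  then show ?case using comp by simp
qed

text \<open>
  Right translations are isometries, so all translates of \<open>f\<close> share its modulus of continuity.
\<close>

lemma means_modulus:
  assumes "P \<in> right_means"
    and "\<And>x y. x \<in> G \<Longrightarrow> y \<in> G \<Longrightarrow> dist x y < \<delta> \<Longrightarrow> \<bar>f x - f y\<bar> \<le> \<eta>"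
    and "x \<in> G" and "y \<in> G" and "dist x y < \<delta>"
  shows "\<bar>P f x - P f y\<bar> \<le> \<eta>"
  using assms
proof (induction arbitrary: f x y)
  case (average A)
  have b: "\<bar>f (x \<cdot> a) - f (y \<cdot> a)\<bar> \<le> \<eta>" if "a \<in> A" for a
    using average that mul_closed dist_right by (metis subsetD)
  have pos: "card A > 0"
    using average by (simp add: card_gt_0_iff)
  have "\<bar>\<Sum>a\<in>A. f (x \<cdot> a) - f (y \<cdot> a)\<bar> \<le> real (card A) * \<eta>"
    using b by (intro order_trans[OF sum_abs] sum_bounded_above)
  then show ?case
    using pos by (simp add: sum_subtractf field_simps flip: diff_divide_distrib)
next
  case (comp P Q)
  show ?case by (rule comp.IH(1)) (use comp in auto)
qed

lemma means_uniformly_continuous: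
  assumes "P \<in> right_means" and "uniformly_continuous_on G f"
  shows "uniformly_continuous_on G (P f)"
  unfolding uniformly_continuous_on_def
proof (intro allI impI)
  fix e :: real assume "e > 0"
  then obtain \<delta> where d: "\<delta> > 0"
      "\<And>x y. x \<in> G \<Longrightarrow> y \<in> G \<Longrightarrow> dist y x < \<delta> \<Longrightarrow> dist (f y) (f x) < e/2"
    using assms(2) unfolding uniformly_continuous_on_def by (metis half_gt_zero)
  have "\<bar>P f y - P f x\<bar> \<le> e/2" if "x \<in> G" "y \<in> G" "dist y x < \<delta>" for x y
    by (rule means_modulus[OF assms(1) _ that(2,1,3)]) (use d(2) in \<open>force simp: dist_real_def\<close>)
  then show "\<exists>d>0. \<forall>x\<in>G. \<forall>y\<in>G. dist y x < d \<longrightarrow> dist (P f y) (P f x) < e"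
    using d(1) \<open>e > 0\<close> by (intro exI[of _ \<delta>]) (force simp: dist_real_def)
qed

text \<open>
  Associativity makes right translations commute with left ones, and means are linear combinations
  of translations.
\<close>

lemma means_commute:
  assumes P: "P \<in> right_means" and "Q \<in> left_means" and "x \<in> G"
  shows "P (Q f) x = Q (P f) x"
  using assms(2,3)
proof (induction arbitrary: f x)
  case (average B)
  have "P (\<lambda>x. (\<Sum>b\<in>B. f (b \<cdot> x)) / real (card B)) x
      = (\<Sum>b\<in>B. P (\<lambda>y. f (b \<cdot> y)) x) / real (card B)"
    using means_scale[OF P, of "1 / card B" "\<lambda>x. \<Sum>b\<in>B. f (b \<cdot> x)"]
      means_sum[OF P average(1), of "\<lambda>b x. f (b \<cdot> x)"] by (simp add: field_simps)
  also have "(\<Sum>b\<in>B. P (\<lambda>y. f (b \<cdot> y)) x) = (\<Sum>b\<in>B. P f (b \<cdot> x))"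
    using average means_translate[OF P] by (intro sum.cong) auto
  finally show ?case .
next
  case (comp Q R)
  have "P (Q (R f)) x = Q (P (R f)) x"
    using comp by blast
  also have "\<dots> = Q (R (P f)) x"
    by (rule compact_metric_group.means_cong[OF opposite comp.hyps(1)]) (use comp in auto)
  finally show ?case .
qed

text \<open>
  A left translate of a net is a net, so one of the points \<open>x \<cdot> a\<close> is close to \<open>z\<close>, where \<open>f\<close> is at
  most \<open>t\<close>; at the other points the trivial bound \<open>hi\<close> is used.
\<close>

lemma average_below_top:
  assumes A: "finite A" "A \<subseteq> G" and net: "\<And>z. z \<in> G \<Longrightarrow> \<exists>a\<in>A. dist a z < \<delta>"
    and mod: "\<And>x y. x \<in> G \<Longrightarrow> y \<in> G \<Longrightarrow> dist x y < \<delta> \<Longrightarrow> \<bar>f x - f y\<bar> \<le> \<eta>"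
    and top: "\<And>y. y \<in> G \<Longrightarrow> f y \<le> hi" and z: "z \<in> G" "f z \<le> t" and x: "x \<in> G"
  shows "(\<Sum>a\<in>A. f (x \<cdot> a)) / real (card A) \<le> hi - (hi - t - \<eta>) / real (card A)"
proof -
  obtain w where w: "w \<in> G" "x \<cdot> w = z"
    using left_divide[OF x z(1)] by blast
  obtain a where a: "a \<in> A" "dist a w < \<delta>"
    using net[OF w(1)] by blast
  have aG: "a \<in> G" using a A by blast
  have "\<bar>f (x \<cdot> a) - f z\<bar> \<le> \<eta>"
    using mod[of "x \<cdot> a" "x \<cdot> w"] dist_left[OF aG w(1) x] a w x z aG mul_closed by simp
  then have "f (x \<cdot> a) \<le> t + \<eta>" using z by linarith
  moreover have "(\<Sum>b\<in>A - {a}. f (x \<cdot> b)) \<le> real (card (A - {a})) * hi"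
    using sum_bounded_above[of "A - {a}" "\<lambda>b. f (x \<cdot> b)" hi] top mul_closed x A by (simp add: subset_iff)
  moreover have "real (card (A - {a})) = real (card A) - 1"
    using a A by (simp add: card_Diff_singleton) (metis One_nat_def Suc_leI card_gt_0_iff empty_iff of_nat_diff of_nat_1)
  moreover have "(\<Sum>b\<in>A. f (x \<cdot> b)) = f (x \<cdot> a) + (\<Sum>b\<in>A - {a}. f (x \<cdot> b))"
    by (rule sum.remove) (use A a in auto)
  ultimately have "(\<Sum>b\<in>A. f (x \<cdot> b)) \<le> t + \<eta> + (real (card A) - 1) * hi"
    by simp
  moreover have "card A > 0" using a A by (auto simp: card_gt_0_iff)
  ultimately show ?thesis by (simp add: field_simps)
qed

text \<open>
  Fix \<open>\<eta> = \<epsilon> / 4\<close>, a net for the corresponding modulus of continuity, and let \<open>n\<close> be its size.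
  According as the value at a chosen point is below or above the middle of the range, averaging
  lowers the upper or
  raises the lower bound, and the width \<open>w\<close> of the range becomes at most \<open>q * w + \<eta> / n\<close> with
  \<open>q = 1 - 1 / (2 * n)\<close>. The fixed point of this recursion is \<open>2 * \<eta>\<close>.
\<close>

lemma almost_constant_mean:
  assumes f: "uniformly_continuous_on G f" and "\<epsilon> > 0"
  shows "\<exists>P\<in>right_means. \<exists>c. \<forall>x\<in>G. \<bar>P f x - c\<bar> \<le> \<epsilon>"
proof -
  define \<eta> where "\<eta> = \<epsilon> / 4"
  have "\<eta> > 0" using \<open>\<epsilon> > 0\<close> by (simp add: \<eta>_def)
  then obtain \<delta> where \<delta>: "\<delta> > 0"
      "\<And>x y. x \<in> G \<Longrightarrow> y \<in> G \<Longrightarrow> dist x y < \<delta> \<Longrightarrow> \<bar>f x - f y\<bar> \<le> \<eta>"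
    using f unfolding uniformly_continuous_on_def dist_real_def by (metis less_imp_le)
  obtain A where A: "finite A" "A \<subseteq> G" "G \<subseteq> (\<Union>a\<in>A. ball a \<delta>)"
    using compactE_image[OF compact, of G "\<lambda>a. ball a \<delta>"] \<delta>(1) by (metis UN_I centre_in_ball open_ball subsetI)
  then have net: "\<exists>a\<in>A. dist a z < \<delta>" if "z \<in> G" for z
    using that by (fastforce simp: mem_ball)
  have ne: "A \<noteq> {}" using A nonempty by auto
  define n where "n = real (card A)"
  have n: "n \<ge> 1" using ne A unfolding n_def by (metis One_nat_def Suc_leI card_gt_0_iff of_nat_1 of_nat_le_iff)
  define q where "q = 1 - 1 / (2 * n)"
  define Av where "Av = (\<lambda>f x. (\<Sum>a\<in>A. f (x \<cdot> a)) / real (card A))"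
  have Av: "Av \<in> right_means" unfolding Av_def by (rule means.average) (use A ne in auto)
  obtain z where z: "z \<in> G" using nonempty by blast
  have "bounded (f ` G)"
    using compact f by (simp add: compact_continuous_image compact_imp_bounded uniformly_continuous_imp_continuous)
  then obtain K where K: "\<And>x. x \<in> G \<Longrightarrow> \<bar>f x\<bar> \<le> K"
    unfolding bounded_iff by (auto simp: real_norm_def)
  \<comment> \<open>The same net serves in every step, as averaging does not spoil the modulus of continuity.\<close>
  have iter: "\<exists>P\<in>right_means. \<exists>lo hi. (\<forall>x\<in>G. lo \<le> P f x \<and> P f x \<le> hi) \<and> hi - lo \<le> q ^ k * (2 * K) + 2 * \<eta>" for k
  proof (induction k)
    case 0
    have b: "- K \<le> f x \<and> f x \<le> K" if "x \<in> G" for x using K[OF that] by linarith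
    have "\<forall>x\<in>G. - K \<le> Av f x \<and> Av f x \<le> K"
      using means_bounds[OF Av, of "-K" f K] b by blast
    then show ?case using Av \<open>\<eta> > 0\<close> by (intro bexI[of _ Av] exI[of _ "-K"] exI[of _ K]) auto
  next
    case (Suc k)
    then obtain P lo hi where P: "P \<in> right_means" "\<And>x. x \<in> G \<Longrightarrow> lo \<le> P f x \<and> P f x \<le> hi"
        "hi - lo \<le> q ^ k * (2 * K) + 2 * \<eta>" by blast
    have mod: "\<bar>P f x - P f y\<bar> \<le> \<eta>" if "x \<in> G" "y \<in> G" "dist x y < \<delta>" for x y
      by (rule means_modulus[OF P(1) _ that]) (rule \<delta>(2))
    have P': "(\<lambda>f. Av (P f)) \<in> right_means" using Av P(1) by (rule means.comp)
    have bnd: "lo \<le> Av (P f) x \<and> Av (P f) x \<le> hi" if "x \<in> G" for x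
      using means_bounds[OF Av] P(2) that by blast
    define s where "s = ((hi - lo) / 2 - \<eta>) / n"
    have "q * (hi - lo) + \<eta> / n \<le> q * (q ^ k * (2 * K) + 2 * \<eta>) + \<eta> / n"
      using P(3) n by (intro add_right_mono mult_left_mono) (auto simp: q_def field_simps)
    also have "\<dots> = q ^ Suc k * (2 * K) + 2 * \<eta>"
      using n by (simp add: q_def field_simps)
    finally have width: "hi - lo - s \<le> q ^ Suc k * (2 * K) + 2 * \<eta>"
      using n by (simp add: s_def q_def field_simps)
    have "\<exists>lo' hi'. (\<forall>x\<in>G. lo' \<le> Av (P f) x \<and> Av (P f) x \<le> hi') \<and> hi' - lo' = hi - lo - s"
    proof (cases "P f z \<le> (lo + hi) / 2")
      case True
      have "(\<Sum>a\<in>A. P f (x \<cdot> a)) / real (card A) \<le> hi - (hi - (lo + hi) / 2 - \<eta>) / real (card A)"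
        if "x \<in> G" for x
        by (rule average_below_top[OF A(1,2) net, where f = "P f"]) (use True z that P(2) mod in auto)
      then have "Av (P f) x \<le> hi - s" if "x \<in> G" for x
        using that unfolding Av_def s_def n_def by (simp add: field_simps)
      then show ?thesis using bnd by (intro exI[of _ lo] exI[of _ "hi - s"]) auto
    next
      case False
      have "(\<Sum>a\<in>A. - P f (x \<cdot> a)) / real (card A) \<le> - lo - (- lo - - (lo + hi) / 2 - \<eta>) / real (card A)"
        if "x \<in> G" for x
        by (rule average_below_top[OF A(1,2) net, where f = "\<lambda>x. - P f x"])
          (use False z that P(2) mod in \<open>auto simp: abs_minus_commute\<close>)
      then have "lo + s \<le> Av (P f) x" if "x \<in> G" for x
        using that unfolding Av_def s_def n_def by (simp add: sum_negf field_simps)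
      then show ?thesis using bnd by (intro exI[of _ "lo + s"] exI[of _ hi]) auto
    qed
    then show ?case using width P' by (metis (no_types, lifting))
  qed
  have "(\<lambda>k. q ^ k * (2 * K)) \<longlonglongrightarrow> 0 * (2 * K)"
    using n by (intro tendsto_intros LIMSEQ_power_zero) (auto simp: q_def abs_if field_simps)
  then have "eventually (\<lambda>k. q ^ k * (2 * K) < 2 * \<eta>) sequentially"
    using \<open>\<eta> > 0\<close> by (intro order_tendstoD) auto
  then obtain k where "q ^ k * (2 * K) < 2 * \<eta>"
    by (meson eventually_happens' sequentially_bot)
  then obtain P lo hi where P: "P \<in> right_means" "\<forall>x\<in>G. lo \<le> P f x \<and> P f x \<le> hi"
      "hi - lo \<le> \<epsilon>"
    using iter[of k] unfolding \<eta>_def by force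
  then show ?thesis by (intro bexI[of _ P] exI[of _ lo]) force+
qed

text \<open>
  Existence and uniqueness of the constant are established for uniformly continuous functions;
  there, right means give the same value, by \<open>mean_approx\<close>.
\<close>

definition mean :: "('a \<Rightarrow> real) \<Rightarrow> real"
  where "mean f = (THE c. \<forall>\<epsilon>>0. \<exists>Q\<in>left_means. \<forall>x\<in>G. \<bar>Q f x - c\<bar> \<le> \<epsilon>)"

lemma mean_cong:
  assumes "\<And>x. x \<in> G \<Longrightarrow> f x = g x"
  shows "mean f = mean g"
proof -
  have eq: "Q f x = Q g x" if "Q \<in> left_means" "x \<in> G" for Q x
    by (rule compact_metric_group.means_cong[OF opposite that(1) assms that(2)])
  have "(\<exists>Q\<in>left_means. \<forall>x\<in>G. \<bar>Q f x - c\<bar> \<le> \<epsilon>) = (\<exists>Q\<in>left_means. \<forall>x\<in>G. \<bar>Q g x - c\<bar> \<le> \<epsilon>)" for c \<epsilon>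
  proof (intro bex_cong ball_cong refl)
    show "(\<bar>Q f x - c\<bar> \<le> \<epsilon>) = (\<bar>Q g x - c\<bar> \<le> \<epsilon>)" if "Q \<in> left_means" "x \<in> G" for Q x
      using eq[OF that] by simp
  qed
  then show ?thesis by (simp add: mean_def)
qed

lemma means_const:
  assumes "P \<in> right_means" and "\<And>x. x \<in> G \<Longrightarrow> \<bar>f x - c\<bar> \<le> \<epsilon>" and "x \<in> G"
  shows "\<bar>P f x - c\<bar> \<le> \<epsilon>"
proof -
  have "c - \<epsilon> \<le> P f x \<and> P f x \<le> c + \<epsilon>"
    by (rule means_bounds[OF assms(1) _ assms(3)]) (use assms(2) in \<open>force simp: abs_le_iff\<close>)
  then show ?thesis by linarith
qed

text \<open>
  Both constants are approximated by \<open>P (Q f) = Q (P f)\<close>.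
\<close>

lemma left_right_close:
  assumes P: "P \<in> right_means" "\<And>x. x \<in> G \<Longrightarrow> \<bar>P f x - c\<bar> \<le> \<epsilon>"
    and Q: "Q \<in> left_means" "\<And>x. x \<in> G \<Longrightarrow> \<bar>Q f x - c'\<bar> \<le> \<epsilon>'"
  shows "\<bar>c - c'\<bar> \<le> \<epsilon> + \<epsilon>'"
proof -
  obtain x where x: "x \<in> G" using nonempty by blast
  have "\<bar>Q (P f) x - c\<bar> \<le> \<epsilon>"
    by (rule compact_metric_group.means_const[OF opposite Q(1) P(2) x])
  moreover have "\<bar>P (Q f) x - c'\<bar> \<le> \<epsilon>'"
    by (rule means_const[OF P(1) Q(2) x])
  ultimately show ?thesis
    using means_commute[OF P(1) Q(1) x, of f] by linarith
qed

text \<open>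
  Constants approximated by right means are close to those approximated by left means, hence to
  each other, and so form a Cauchy sequence as the error tends to \<open>0\<close>.
\<close>

lemma mean_exists:
  assumes f: "uniformly_continuous_on G f"
  shows "\<exists>c. (\<forall>\<epsilon>>0. \<exists>P\<in>right_means. \<forall>x\<in>G. \<bar>P f x - c\<bar> \<le> \<epsilon>) \<and>
             (\<forall>\<epsilon>>0. \<exists>Q\<in>left_means. \<forall>x\<in>G. \<bar>Q f x - c\<bar> \<le> \<epsilon>)"
proof -
  have "\<exists>P c. P \<in> right_means \<and> (\<forall>x\<in>G. \<bar>P f x - c\<bar> \<le> inverse (Suc n))" for n
    using almost_constant_mean[OF f, of "inverse (Suc n)"] by auto
  then obtain P c where P: "\<And>n. P n \<in> right_means" "\<And>n x. x \<in> G \<Longrightarrow> \<bar>P n f x - c n\<bar> \<le> inverse (Suc n)"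
    by metis
  have "\<exists>Q c. Q \<in> left_means \<and> (\<forall>x\<in>G. \<bar>Q f x - c\<bar> \<le> inverse (Suc n))" for n
    using compact_metric_group.almost_constant_mean[OF opposite f, of "inverse (Suc n)"] by auto
  then obtain Q c' where Q: "\<And>n. Q n \<in> left_means" "\<And>n x. x \<in> G \<Longrightarrow> \<bar>Q n f x - c' n\<bar> \<le> inverse (Suc n)"
    by metis
  have close: "\<bar>c m - c' n\<bar> \<le> inverse (Suc m) + inverse (Suc n)" for m n
    by (rule left_right_close[OF P Q])
  have lim0: "(\<lambda>n. inverse (real (Suc n))) \<longlonglongrightarrow> 0"
    by (rule LIMSEQ_inverse_real_of_nat)
  have "Cauchy c"
  proof (rule metric_CauchyI)
    fix e :: real assume "e > 0"
    then obtain N where N: "\<And>n. n \<ge> N \<Longrightarrow> inverse (real (Suc n)) < e / 4"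
      using order_tendstoD(2)[OF lim0, of "e/4"] unfolding eventually_sequentially by auto
    have "dist (c m) (c n) < e" if "m \<ge> N" "n \<ge> N" for m n
      using close[of m N] close[of n N] N[OF that(1)] N[OF that(2)] N[of N] by (simp add: dist_real_def)
    then show "\<exists>M. \<forall>m\<ge>M. \<forall>n\<ge>M. dist (c m) (c n) < e" by blast
  qed
  then obtain l where l: "c \<longlonglongrightarrow> l"
    using Cauchy_convergent_iff convergent_def by blast
  have l': "\<bar>l - c' n\<bar> \<le> inverse (Suc n)" for n
  proof (rule tendsto_le[OF _ _ _ always_eventually])
    show "(\<lambda>m. inverse (real (Suc m)) + inverse (real (Suc n))) \<longlonglongrightarrow> inverse (Suc n)"
      using tendsto_add[OF lim0 tendsto_const[of "inverse (real (Suc n))"]] by simp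
    show "(\<lambda>m. \<bar>c m - c' n\<bar>) \<longlonglongrightarrow> \<bar>l - c' n\<bar>"
      using l by (intro tendsto_intros)
  qed (use close in auto)
  show ?thesis
  proof (intro exI[of _ l] conjI allI impI)
    fix \<epsilon> :: real assume "\<epsilon> > 0"
    obtain n where n: "inverse (real (Suc n)) < \<epsilon> / 2" 
      using reals_Archimedean[of "\<epsilon>/2"] \<open>\<epsilon> > 0\<close> by auto
    show "\<exists>Q\<in>left_means. \<forall>x\<in>G. \<bar>Q f x - l\<bar> \<le> \<epsilon>"
    proof (intro bexI[of _ "Q n"] ballI)
      show "\<bar>Q n f x - l\<bar> \<le> \<epsilon>" if "x \<in> G" for x
        using Q(2)[OF that, of n] l'[of n] n by linarith
    qed (rule Q(1))
    obtain m where m: "\<bar>c m - l\<bar> < \<epsilon> / 2" "inverse (real (Suc m)) < \<epsilon> / 2"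
    proof -
      have "eventually (\<lambda>m. \<bar>c m - l\<bar> < \<epsilon> / 2) sequentially"
        using tendstoD[OF l, of "\<epsilon>/2"] \<open>\<epsilon> > 0\<close> by (simp add: dist_real_def)
      moreover have "eventually (\<lambda>m. inverse (real (Suc m)) < \<epsilon> / 2) sequentially"
        using order_tendstoD(2)[OF lim0, of "\<epsilon>/2"] \<open>\<epsilon> > 0\<close> by simp
      ultimately show ?thesis
        using that eventually_happens'[OF sequentially_bot eventually_conj] by blast
    qed
    show "\<exists>P\<in>right_means. \<forall>x\<in>G. \<bar>P f x - l\<bar> \<le> \<epsilon>"
    proof (intro bexI[of _ "P m"] ballI)
      show "\<bar>P m f x - l\<bar> \<le> \<epsilon>" if "x \<in> G" for x
        using P(2)[OF that, of m] m by linarith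
    qed (rule P(1))
  qed
qed

lemma mean_approx:
  assumes f: "uniformly_continuous_on G f" and "\<epsilon> > 0"
  shows mean_right: "\<exists>P\<in>right_means. \<forall>x\<in>G. \<bar>P f x - mean f\<bar> \<le> \<epsilon>"
    and mean_left: "\<exists>Q\<in>left_means. \<forall>x\<in>G. \<bar>Q f x - mean f\<bar> \<le> \<epsilon>"
proof -
  obtain c where r: "\<And>\<epsilon>. \<epsilon> > 0 \<Longrightarrow> \<exists>P\<in>right_means. \<forall>x\<in>G. \<bar>P f x - c\<bar> \<le> \<epsilon>"
    and l: "\<forall>\<epsilon>>0. \<exists>Q\<in>left_means. \<forall>x\<in>G. \<bar>Q f x - c\<bar> \<le> \<epsilon>"
    using mean_exists[OF f] by blast
  have "mean f = c"
    unfolding mean_def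
  proof (rule the_equality, rule l)
    fix c' assume l': "\<forall>\<epsilon>>0. \<exists>Q\<in>left_means. \<forall>x\<in>G. \<bar>Q f x - c'\<bar> \<le> \<epsilon>"
    have "\<bar>c - c'\<bar> \<le> e" if "e > 0" for e
      using r[of "e/2"] l' that left_right_close[of _ f c "e/2" _ c' "e/2"] by (metis field_sum_of_halves half_gt_zero)
    then show "c' = c" by (metis abs_le_zero_iff dense_ge eq_iff_diff_eq_0)
  qed
  then show "\<exists>P\<in>right_means. \<forall>x\<in>G. \<bar>P f x - mean f\<bar> \<le> \<epsilon>"
    and "\<exists>Q\<in>left_means. \<forall>x\<in>G. \<bar>Q f x - mean f\<bar> \<le> \<epsilon>"
    using r l \<open>\<epsilon> > 0\<close> by auto
qed

lemma mean_eqI_left: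
  assumes f: "uniformly_continuous_on G f"
    and "\<And>\<epsilon>. \<epsilon> > 0 \<Longrightarrow> \<exists>Q\<in>left_means. \<forall>x\<in>G. \<bar>Q f x - c\<bar> \<le> \<epsilon>"
  shows "mean f = c"
proof -
  have "\<bar>mean f - c\<bar> \<le> e" if "e > 0" for e
    using mean_right[OF f, of "e/2"] assms(2)[of "e/2"] that left_right_close[of _ f "mean f" "e/2" _ c "e/2"]
    by (metis field_sum_of_halves half_gt_zero)
  then show ?thesis by (metis abs_le_zero_iff dense_ge eq_iff_diff_eq_0)
qed

lemma mean_eqI_right:
  assumes f: "uniformly_continuous_on G f"
    and "\<And>\<epsilon>. \<epsilon> > 0 \<Longrightarrow> \<exists>P\<in>right_means. \<forall>x\<in>G. \<bar>P f x - c\<bar> \<le> \<epsilon>"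
  shows "mean f = c"
proof -
  have "\<bar>c - mean f\<bar> \<le> e" if "e > 0" for e
    using mean_left[OF f, of "e/2"] assms(2)[of "e/2"] that left_right_close[of _ f c "e/2" _ "mean f" "e/2"]
    by (metis field_sum_of_halves half_gt_zero)
  then show ?thesis by (metis abs_le_zero_iff dense_ge eq_iff_diff_eq_0)
qed

text \<open>
  If \<open>P\<close> makes \<open>g\<close> nearly constant, then \<open>P (Q g) = Q (P g)\<close> is near the same constant.
\<close>

lemma mean_left_means:
  assumes g: "uniformly_continuous_on G g" and Q: "Q \<in> left_means"
  shows "mean (Q g) = mean g"
proof (rule mean_eqI_right)
  show "uniformly_continuous_on G (Q g)"
    using compact_metric_group.means_uniformly_continuous[OF opposite Q g] .
  fix \<epsilon> :: real assume "\<epsilon> > 0"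
  then obtain P where P: "P \<in> right_means" "\<And>x. x \<in> G \<Longrightarrow> \<bar>P g x - mean g\<bar> \<le> \<epsilon>"
    using mean_right[OF g] by blast
  have "\<bar>P (Q g) x - mean g\<bar> \<le> \<epsilon>" if "x \<in> G" for x
    using compact_metric_group.means_const[OF opposite Q P(2) that] means_commute[OF P(1) Q that] by simp
  then show "\<exists>P\<in>right_means. \<forall>x\<in>G. \<bar>P (Q g) x - mean g\<bar> \<le> \<epsilon>" using P(1) by blast
qed

text \<open>
  A left mean \<open>Q\<close> adapted to \<open>f\<close> need not be adapted to \<open>g\<close>, but it leaves the mean of \<open>g\<close> unchanged,
  so it may be followed by a left mean \<open>R\<close> adapted to \<open>Q g\<close>, which keeps \<open>Q f\<close> nearly constant.
\<close>

lemma mean_add: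
  assumes f: "uniformly_continuous_on G f" and g: "uniformly_continuous_on G g"
  shows "mean (\<lambda>x. f x + g x) = mean f + mean g"
proof (rule mean_eqI_left)
  show "uniformly_continuous_on G (\<lambda>x. f x + g x)"
    using f g by (rule uniformly_continuous_on_add)
  fix \<epsilon> :: real assume "\<epsilon> > 0"
  then obtain Q where Q: "Q \<in> left_means" "\<And>x. x \<in> G \<Longrightarrow> \<bar>Q f x - mean f\<bar> \<le> \<epsilon> / 2"
    using mean_left[OF f, of "\<epsilon>/2"] by auto
  have "uniformly_continuous_on G (Q g)"
    using compact_metric_group.means_uniformly_continuous[OF opposite Q(1) g] .
  then obtain R where R: "R \<in> left_means" "\<And>x. x \<in> G \<Longrightarrow> \<bar>R (Q g) x - mean g\<bar> \<le> \<epsilon> / 2"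
    using mean_left[of "Q g" "\<epsilon>/2"] mean_left_means[OF g Q(1)] \<open>\<epsilon> > 0\<close> by auto
  have "\<bar>R (Q (\<lambda>x. f x + g x)) x - (mean f + mean g)\<bar> \<le> \<epsilon>" if "x \<in> G" for x
  proof -
    have "\<bar>R (Q f) x - mean f\<bar> \<le> \<epsilon> / 2"
      by (rule compact_metric_group.means_const[OF opposite R(1) Q(2) that])
    then have "\<bar>R (Q f) x + R (Q g) x - (mean f + mean g)\<bar> \<le> \<epsilon>"
      using R(2)[OF that] by linarith
    then show ?thesis
      using compact_metric_group.means_add[OF opposite Q(1), of f g]
        compact_metric_group.means_add[OF opposite R(1), of "Q f" "Q g"] by simp
  qed
  then show "\<exists>Q\<in>left_means. \<forall>x\<in>G. \<bar>Q (\<lambda>x. f x + g x) x - (mean f + mean g)\<bar> \<le> \<epsilon>"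
    using means.comp[OF R(1) Q(1)] by (intro bexI[of _ "\<lambda>f. R (Q f)"]) auto
qed

lemma mean_scale:
  assumes f: "uniformly_continuous_on G f"
  shows "mean (\<lambda>x. c * f x) = c * mean f"
proof (rule mean_eqI_left)
  show "uniformly_continuous_on G (\<lambda>x. c * f x)"
    using f by (intro bounded_linear.uniformly_continuous_on[OF bounded_linear_mult_right])
  fix \<epsilon> :: real assume "\<epsilon> > 0"
  then obtain Q where Q: "Q \<in> left_means" "\<And>x. x \<in> G \<Longrightarrow> \<bar>Q f x - mean f\<bar> \<le> \<epsilon> / (\<bar>c\<bar> + 1)"
    using mean_left[OF f, of "\<epsilon> / (\<bar>c\<bar> + 1)"] by auto
  have "\<bar>c * Q f x - c * mean f\<bar> \<le> \<epsilon>" if "x \<in> G" for x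
  proof -
    have "\<bar>c * Q f x - c * mean f\<bar> = \<bar>c\<bar> * \<bar>Q f x - mean f\<bar>"
      by (simp add: right_diff_distrib flip: abs_mult)
    also have "\<dots> \<le> \<bar>c\<bar> * (\<epsilon> / (\<bar>c\<bar> + 1))"
      using Q(2)[OF that] by (intro mult_left_mono) auto
    also have "\<dots> \<le> \<epsilon>" using \<open>\<epsilon> > 0\<close> by (simp add: field_simps)
    finally show ?thesis .
  qed
  then show "\<exists>Q\<in>left_means. \<forall>x\<in>G. \<bar>Q (\<lambda>x. c * f x) x - c * mean f\<bar> \<le> \<epsilon>"
    using Q(1) by (intro bexI[of _ Q]) (simp_all add: compact_metric_group.means_scale[OF opposite])
qed

lemma mean_bounds:
  assumes f: "uniformly_continuous_on G f" and "\<And>x. x \<in> G \<Longrightarrow> lo \<le> f x \<and> f x \<le> hi"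
  shows "lo \<le> mean f \<and> mean f \<le> hi"
proof -
  have approx: "lo \<le> mean f + e \<and> mean f - e \<le> hi" if e: "e > 0" for e
  proof -
    obtain P where P: "P \<in> right_means" "\<And>x. x \<in> G \<Longrightarrow> \<bar>P f x - mean f\<bar> \<le> e"
      using mean_right[OF f e] by blast
    obtain x where x: "x \<in> G" using nonempty by blast
    show ?thesis using means_bounds[OF P(1) assms(2) x] P(2)[OF x] by force
  qed
  have "lo \<le> mean f"
    by (rule field_le_epsilon) (use approx in blast)
  moreover have "mean f \<le> hi"
  proof (rule field_le_epsilon)
    show "mean f \<le> hi + e" if "e > 0" for e
      using approx[OF that] by linarith
  qed
  ultimately show ?thesis by simp
qed

text \<open>
  Left means commute with right translations, and right translations permute the group.
\<close>

lemma mean_right_translate: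
  assumes f: "uniformly_continuous_on G f" and u: "u \<in> G"
  shows "mean (\<lambda>x. f (x \<cdot> u)) = mean f"
proof (rule mean_eqI_left)
  show "uniformly_continuous_on G (\<lambda>x. f (x \<cdot> u))"
    using f u mul_closed dist_right unfolding uniformly_continuous_on_def by metis
  fix \<epsilon> :: real assume "\<epsilon> > 0"
  then obtain Q where Q: "Q \<in> left_means" "\<And>x. x \<in> G \<Longrightarrow> \<bar>Q f x - mean f\<bar> \<le> \<epsilon>"
    using mean_left[OF f] by blast
  have "\<bar>Q (\<lambda>x. f (x \<cdot> u)) x - mean f\<bar> \<le> \<epsilon>" if "x \<in> G" for x
    using compact_metric_group.means_translate[OF opposite Q(1) u that, of f] Q(2)[OF mul_closed[OF that u]] by simp
  then show "\<exists>Q\<in>left_means. \<forall>x\<in>G. \<bar>Q (\<lambda>x. f (x \<cdot> u)) x - mean f\<bar> \<le> \<epsilon>"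
    using Q(1) by blast
qed

end

section \<open>The unitary group as a compact metric group\<close>

lemma ctranspose_mult: "ctranspose (u ** v) = ctranspose v ** ctranspose u"
  by (simp add: ctranspose_def matrix_matrix_mult_def vec_eq_iff mult.commute)

lemma ctranspose_ctranspose [simp]: "ctranspose (ctranspose u) = u"
  by (simp add: ctranspose_def vec_eq_iff)

lemma ctranspose_mat_1 [simp]: "ctranspose (mat 1) = mat 1"
  by (simp add: ctranspose_def mat_def vec_eq_iff)

lemma mat_1_unitary: "mat 1 \<in> unitary_group"
  by (simp add: unitary_group_def)

lemma ctranspose_unitary: "u \<in> unitary_group \<Longrightarrow> ctranspose u \<in> unitary_group"
  by (simp add: unitary_group_def)

lemma unitary_cancel:
  assumes "u \<in> unitary_group"
  shows "ctranspose u ** (u ** x) = x" and "u ** (ctranspose u ** x) = x"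
    and "(y ** ctranspose u) ** u = y"
proof -
  show "ctranspose u ** (u ** x) = x" and "u ** (ctranspose u ** x) = x"
    using assms by (simp_all add: unitary_group_def matrix_mul_assoc)
  show "(y ** ctranspose u) ** u = y"
    using assms by (simp add: unitary_group_def flip: matrix_mul_assoc)
qed

lemma unitary_group_mult:
  assumes "u \<in> unitary_group" and "v \<in> unitary_group"
  shows "u ** v \<in> unitary_group"
proof -
  have "(u ** v) ** ctranspose (u ** v) = u ** (v ** (ctranspose v ** ctranspose u))"
    by (simp add: ctranspose_mult matrix_mul_assoc)
  moreover have "ctranspose (u ** v) ** (u ** v) = ctranspose v ** (ctranspose u ** (u ** v))"
    by (simp add: ctranspose_mult matrix_mul_assoc)
  ultimately show ?thesis
    using assms by (simp add: unitary_group_def unitary_cancel)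
qed

text \<open>
  For the Frobenius inner product, the adjoint of multiplication by a matrix is multiplication by
  its conjugate transpose. This makes the Frobenius norm invariant under the unitary group.
\<close>

lemma inner_matrix_mult_left:
  "inner (u ** x) y = inner x (ctranspose u ** (y :: complex^'n::finite^'d::finite))"
proof -
  have adj: "inner (a * b) c = inner b (cnj a * c)" for a b c :: complex
    by (simp add: inner_complex_def algebra_simps)
  have "inner (u ** x) y = (\<Sum>i\<in>UNIV. \<Sum>j\<in>UNIV. \<Sum>k\<in>UNIV. inner (x $ k $ j) (cnj (u $ i $ k) * y $ i $ j))"
    by (simp add: inner_vec_def matrix_matrix_mult_def inner_sum_left adj)
  also have "\<dots> = (\<Sum>i\<in>UNIV. \<Sum>k\<in>UNIV. \<Sum>j\<in>UNIV. inner (x $ k $ j) (cnj (u $ i $ k) * y $ i $ j))"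
    by (intro sum.cong refl sum.swap)
  also have "\<dots> = (\<Sum>k\<in>UNIV. \<Sum>i\<in>UNIV. \<Sum>j\<in>UNIV. inner (x $ k $ j) (cnj (u $ i $ k) * y $ i $ j))"
    by (rule sum.swap)
  also have "\<dots> = (\<Sum>k\<in>UNIV. \<Sum>j\<in>UNIV. \<Sum>i\<in>UNIV. inner (x $ k $ j) (cnj (u $ i $ k) * y $ i $ j))"
    by (intro sum.cong refl sum.swap)
  also have "\<dots> = inner x (ctranspose u ** y)"
    by (simp add: inner_vec_def matrix_matrix_mult_def ctranspose_def inner_sum_right)
  finally show ?thesis .
qed

lemma inner_ctranspose: "inner (ctranspose x) (ctranspose y) = inner x y"
  unfolding inner_vec_def ctranspose_def by (subst sum.swap) (simp add: inner_complex_def)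

lemma norm_unitary_mult:
  fixes u :: "complex^'d::finite^'d"
  assumes "u \<in> unitary_group"
  shows "norm (u ** x) = norm x" and "norm (y ** u) = norm y"
proof -
  have left: "norm (u ** x) = norm x" if "u \<in> unitary_group" for u :: "complex^'d^'d" and x :: "complex^'n::finite^'d"
    using that by (simp add: norm_eq_sqrt_inner inner_matrix_mult_left unitary_cancel)
  then show "norm (u ** x) = norm x" using assms .
  have "norm (y ** u) = norm (ctranspose u ** ctranspose y)"
    by (simp add: norm_eq_sqrt_inner inner_ctranspose flip: ctranspose_mult)
  also have "\<dots> = norm y"
    by (simp add: left ctranspose_unitary assms) (simp add: norm_eq_sqrt_inner inner_ctranspose)
  finally show "norm (y ** u) = norm y" .
qed

lemma compact_unitary_group: "compact (unitary_group :: (complex^'d::finite^'d) set)"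
proof (rule compact_eq_bounded_closed[THEN iffD2], intro conjI)
  have "norm u = norm (mat 1 :: complex^'d^'d)" if "u \<in> unitary_group" for u :: "complex^'d^'d"
    using norm_unitary_mult(1)[OF that, of "mat 1"] by simp
  then show "bounded (unitary_group :: (complex^'d^'d) set)"
    by (intro boundedI[where B = "norm (mat 1 :: complex^'d^'d)"]) simp
  have "closed {u :: complex^'d^'d. u ** ctranspose u = mat 1 \<and> ctranspose u ** u = mat 1}"
    unfolding matrix_matrix_mult_def ctranspose_def
    by (intro closed_Collect_conj closed_Collect_eq continuous_intros)
  then show "closed (unitary_group :: (complex^'d^'d) set)"
    by (simp add: unitary_group_def)
qed

lemma mult_diff_distribs:
  fixes x y z :: "complex^'d::finite^'d"
  shows "z ** x - z ** y = z ** (x - y)" and "x ** z - y ** z = (x - y) ** z"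
  by (simp_all add: matrix_matrix_mult_def vec_eq_iff sum_subtractf algebra_simps)

interpretation unitary: compact_metric_group "unitary_group :: (complex^'d::finite^'d) set" "(**)"
proof
  fix x y z :: "complex^'d^'d"
  assume x: "x \<in> unitary_group" and y: "y \<in> unitary_group"
  show "x ** y \<in> unitary_group"
    using x y by (rule unitary_group_mult)
  show "\<exists>z\<in>unitary_group. x ** z = y" "\<exists>z\<in>unitary_group. z ** x = y"
    using unitary_cancel(2,3)[OF x, of y] x y ctranspose_unitary unitary_group_mult by metis+
  assume z: "z \<in> unitary_group"
  show "x ** y ** z = x ** (y ** z)"
    by (simp add: matrix_mul_assoc)
  show "dist (z ** x) (z ** y) = dist x y" "dist (x ** z) (y ** z) = dist x y"
    by (simp_all add: dist_norm mult_diff_distribs norm_unitary_mult[OF z])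
qed (use compact_unitary_group mat_1_unitary in auto)

section \<open>Uniform boundedness and Riesz representation\<close>

text \<open>
  By Baire's theorem one of the closed sets \<open>C n\<close> of points at which the family is bounded by \<open>n\<close>
  contains a ball; differences of points of the ball reach all directions.
\<close>

lemma uniform_boundedness:
  fixes F :: "'i \<Rightarrow> 'a::banach \<Rightarrow> 'b::real_normed_vector"
  assumes lin: "\<And>i. i \<in> I \<Longrightarrow> bounded_linear (F i)"
    and bdd: "\<And>x. bounded ((\<lambda>i. F i x) ` I)"
  obtains M where "M > 0" and "\<And>i x. i \<in> I \<Longrightarrow> norm (F i x) \<le> M * norm x"
proof -
  define C where "C n = {x. \<forall>i\<in>I. norm (F i x) \<le> real n}" for n
  have closed: "closed (C n)" for n
  proof -
    have "closed {x. norm (F i x) \<le> real n}" if "i \<in> I" for i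
      using lin[OF that] by (intro closed_Collect_le continuous_intros linear_continuous_on) auto
    moreover have "C n = (\<Inter>i\<in>I. {x. norm (F i x) \<le> real n})" by (auto simp: C_def)
    ultimately show ?thesis by (auto intro: closed_INT)
  qed
  have cover: "(\<Union>n. C n) = UNIV"
  proof -
    have "\<exists>n. x \<in> C n" for x
    proof -
      obtain K where "\<And>i. i \<in> I \<Longrightarrow> norm (F i x) \<le> K"
        using bdd[of x] unfolding bounded_iff by auto
      moreover obtain n where "K \<le> real n" using real_arch_simple by blast
      ultimately have "x \<in> C n" unfolding C_def by (auto intro: order_trans)
      then show ?thesis ..
    qed
    then show ?thesis by auto
  qed
  have "\<exists>n. interior (C n) \<noteq> {}"
  proof (rule ccontr)
    assume "\<not> ?thesis"
    then have "Met_TC.mtopology interior_of \<Union> (range C) = {}"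
      using closed by (intro Met_TC.metric_Baire_category_alt) (auto simp: Met_TC.mcomplete_def)
    then show False using cover by simp
  qed
  then obtain n z r where r: "r > 0" "cball z r \<subseteq> C n"
    using mem_interior_cball by blast
  \<comment> \<open>The summand \<open>1\<close> makes the bound positive also for \<open>n = 0\<close>.\<close>
  define M where "M = 2 * real n / r + 1"
  have "norm (F i x) \<le> M * norm x" if i: "i \<in> I" for i x
  proof (cases "x = 0")
    case True
    then show ?thesis using lin[OF i] by (simp add: linear_simps)
  next
    case False
    interpret bounded_linear "F i" using lin[OF i] .
    define y where "y = (r / norm x) *\<^sub>R x"
    have "norm y = r" using False r by (simp add: y_def)
    then have "z + y \<in> C n" "z \<in> C n" using r by (auto simp: subset_iff dist_norm)
    then have "norm (F i (z + y)) \<le> n" "norm (F i z) \<le> n" using i by (auto simp: C_def)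
    moreover have "F i y = F i (z + y) - F i z" by (simp add: add)
    ultimately have "norm (F i y) \<le> 2 * n" 
      using norm_triangle_ineq4[of "F i (z + y)" "F i z"] by simp
    moreover have "norm (F i y) = r / norm x * norm (F i x)"
      using r by (simp add: y_def scaleR)
    ultimately have "norm (F i x) \<le> 2 * n / r * norm x"
      using r False by (simp add: field_simps)
    moreover have "M * norm x = 2 * n / r * norm x + norm x" by (simp add: M_def distrib_right)
    ultimately show ?thesis using norm_ge_zero[of x] by linarith
  qed
  moreover have "M > 0" using r by (simp add: M_def add_nonneg_pos)
  ultimately show ?thesis using that by blast
qed

text \<open>
  The representing vector is the minimiser of \<open>inner x x - 2 * \<phi> x\<close>; vanishing of the derivative at
  the minimum is the representation.
\<close>

lemma riesz_representation:
  fixes \<phi> :: "'a::{real_inner,complete_space} \<Rightarrow> real"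
  assumes "bounded_linear \<phi>"
  shows "\<exists>z. \<forall>x. \<phi> x = inner z x"
proof -
  interpret bounded_linear \<phi> by fact
  obtain K where K: "\<And>x. \<bar>\<phi> x\<bar> \<le> norm x * K" using bounded by auto
  define J where "J x = inner x x - 2 * \<phi> x" for x
  have lower: "- (K\<^sup>2) \<le> J x" for x
  proof -
    have "0 \<le> (norm x - K)\<^sup>2" by simp
    then show ?thesis using K[of x]
      unfolding J_def power2_norm_eq_inner[symmetric] by (simp add: power2_diff)
  qed
  define m where "m = (INF x. J x)"
  have bdd: "bdd_below (range J)" using lower by (rule bdd_belowI2)
  have m: "m \<le> J x" for x unfolding m_def by (rule cINF_lower[OF bdd]) simp
  have "\<exists>x. J x < m + inverse (Suc n)" for n
    using cINF_less_iff[OF _ bdd, of "m + inverse (Suc n)"] unfolding m_def by auto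
  then obtain X where X: "\<And>n. J (X n) < m + inverse (Suc n)" by metis
  \<comment> \<open>The parallelogram law makes a minimising sequence Cauchy.\<close>
  have par: "(norm (x - y))\<^sup>2 = 2 * J x + 2 * J y - 4 * J ((1/2) *\<^sub>R (x + y))" for x y
    unfolding J_def power2_norm_eq_inner
    by (simp add: scaleR add inner_diff_left inner_diff_right inner_add_left inner_add_right inner_commute)
      (simp add: field_simps)
  have close: "(norm (X i - X j))\<^sup>2 \<le> 2 * inverse (Suc i) + 2 * inverse (Suc j)" for i j
    using par[of "X i" "X j"] X[of i] X[of j] m[of "(1/2) *\<^sub>R (X i + X j)"] by linarith
  have lim0: "(\<lambda>n. inverse (real (Suc n))) \<longlonglongrightarrow> 0"
    by (rule LIMSEQ_inverse_real_of_nat)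
  have "Cauchy X"
  proof (rule metric_CauchyI)
    fix e :: real assume "e > 0"
    then obtain N where N: "\<And>n. n \<ge> N \<Longrightarrow> inverse (real (Suc n)) < e\<^sup>2 / 4"
      using order_tendstoD(2)[OF lim0, of "e\<^sup>2/4"] unfolding eventually_sequentially by auto
    have "dist (X i) (X j) < e" if "i \<ge> N" "j \<ge> N" for i j
    proof -
      have "(norm (X i - X j))\<^sup>2 < e\<^sup>2"
        using close[of i j] N[OF that(1)] N[OF that(2)] by linarith
      then show ?thesis using \<open>e > 0\<close> by (simp add: dist_norm power2_less_imp_less)
    qed
    then show "\<exists>M. \<forall>m\<ge>M. \<forall>n\<ge>M. dist (X m) (X n) < e" by blast
  qed
  then obtain z where z: "X \<longlonglongrightarrow> z"
    using Cauchy_convergent_iff convergent_def by blast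
  have "J z \<le> m"
  proof (rule tendsto_le[OF _ _ _ always_eventually])
    show "(\<lambda>n. m + inverse (real (Suc n))) \<longlonglongrightarrow> m"
      using tendsto_add[OF tendsto_const lim0, of m] by simp
    show "(\<lambda>n. J (X n)) \<longlonglongrightarrow> J z"
      unfolding J_def by (intro tendsto_intros z tendsto)
  qed (use X less_imp_le in auto)
  have "\<phi> x = inner z x" for x
  proof (rule ccontr)
    assume ne: "\<phi> x \<noteq> inner z x"
    then have "x \<noteq> 0" by auto
    then have pos: "inner x x > 0" by simp
    \<comment> \<open>The step \<open>t\<close> minimises the quadratic polynomial \<open>J (z + t *\<^sub>R x)\<close>.\<close>
    define t where "t = (\<phi> x - inner z x) / inner x x"
    have "J (z + t *\<^sub>R x) = J z - (\<phi> x - inner z x)\<^sup>2 / inner x x"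
      using pos unfolding J_def t_def
      by (simp add: add scaleR inner_add_left inner_add_right inner_commute field_simps power2_eq_square)
    also have "\<dots> < J z" using ne pos by simp
    finally show False using m[of "z + t *\<^sub>R x"] \<open>J z \<le> m\<close> by simp
  qed
  then show ?thesis by blast
qed

section \<open>Complex inner products and complex-linear operators\<close>

instance complex_hilbert \<subseteq> banach ..

lemma cinner_scaleC_right: "cinner x (a *\<^sub>C y) = cnj a * cinner x y"
  by (metis cinner_commute cinner_scaleC_left complex_cnj_mult)

lemma inner_scaleC_left: "inner (a *\<^sub>C x) y = inner x (cnj a *\<^sub>C y)"
  by (simp add: cinner_scaleC_left cinner_scaleC_right flip: Re_cinner)

text \<open>
  Complex-linear maps that preserve the real inner product therefore preserve the complex one.
\<close>

lemma cinner_eq_inner: "cinner x y = Complex (inner x y) (inner x (\<i> *\<^sub>C y))"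
  by (simp add: complex_eq_iff cinner_scaleC_right flip: Re_cinner)

lemma norm_scaleC: "norm (a *\<^sub>C x) = cmod a * norm x"
proof -
  have "(norm (a *\<^sub>C x))\<^sup>2 = (cmod a * norm x)\<^sup>2"
  proof -
    have "cnj a * a = complex_of_real ((cmod a)\<^sup>2)"
      by (metis complex_norm_square mult.commute)
    then have "inner (a *\<^sub>C x) (a *\<^sub>C x) = (cmod a)\<^sup>2 * inner x x"
      by (simp only: inner_scaleC_left scaleC_scaleC scaleC_of_real inner_scaleR_right)
    then show ?thesis
      by (simp only: power2_norm_eq_inner power_mult_distrib)
  qed
  then show ?thesis by (simp add: power2_eq_iff_nonneg)
qed

lemma bounded_linear_scaleC: "bounded_linear ((*\<^sub>C) a)"
proof (rule bounded_linear_intro[of _ "cmod a"])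
  show "a *\<^sub>C (r *\<^sub>R x) = r *\<^sub>R (a *\<^sub>C x)" for r x
    by (metis mult.commute scaleC_of_real scaleC_scaleC)
qed (simp_all add: scaleC_add_right norm_scaleC mult.commute)

lemma bounded_clinear_compose:
  "bounded_clinear A \<Longrightarrow> bounded_clinear B \<Longrightarrow> bounded_clinear (A \<circ> B)"
  by (auto simp: bounded_clinear_def comp_def intro: bounded_linear_compose)

lemma bounded_clinear_sum:
  assumes "bounded_clinear A"
  shows "A (\<Sum>k\<in>K. c k *\<^sub>C f k) = (\<Sum>k\<in>K. c k *\<^sub>C A (f k))"
proof -
  interpret bounded_linear A using assms by (simp add: bounded_clinear_def)
  show ?thesis using assms by (simp add: sum bounded_clinear_def)
qed

lemma bounded_invertibleI:
  assumes A: "bounded_clinear A" and surj: "surj A"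
    and m: "m > 0" and lower: "\<And>x. m * norm x \<le> norm (A x)"
  shows "bounded_invertible A"
proof -
  interpret A: bounded_linear A using A by (simp add: bounded_clinear_def)
  have AC: "A (c *\<^sub>C x) = c *\<^sub>C A x" for c x using A by (simp add: bounded_clinear_def)
  have "inj A"
  proof (rule injI)
    fix x y assume "A x = A y"
    then have "m * norm (x - y) \<le> 0" using lower[of "x - y"] by (simp add: A.diff)
    then show "x = y" using m by (simp add: mult_le_0_iff)
  qed
  define B where "B = inv A"
  have BA: "B (A x) = x" and AB: "A (B y) = y" for x y
    using \<open>inj A\<close> surj by (simp_all add: B_def surj_f_inv_f)
  have "bounded_linear B"
  proof (rule bounded_linear_intro[of _ "1 / m"])
    show "B (x + y) = B x + B y" for x y by (metis A.add AB BA)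
    show "B (r *\<^sub>R x) = r *\<^sub>R B x" for r x by (metis A.scaleR AB BA)
    show "norm (B x) \<le> norm x * (1 / m)" for x
      using lower[of "B x"] m by (simp add: AB field_simps)
  qed
  moreover have "B (c *\<^sub>C x) = c *\<^sub>C B x" for c x by (metis AC AB BA)
  ultimately have "bounded_clinear B" by (simp add: bounded_clinear_def)
  then show ?thesis
    using A BA AB unfolding bounded_invertible_def by (intro conjI exI[of _ B]) auto
qed

section \<open>Factorization of equivalent inner products\<close>

text \<open>
  The Cauchy-Schwarz inequality for the form \<open>s\<close>, in the shape in which it follows from polarisation
  on unit vectors.
\<close>

lemma form_bound:
  fixes s :: "'a::real_inner \<Rightarrow> 'a \<Rightarrow> real"
  assumes sym: "\<And>x y. s x y = s y x" and add: "\<And>x y z. s (x + y) z = s x z + s y z"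
    and scale: "\<And>r x y. s (r *\<^sub>R x) y = r * s x y"
    and bounds: "\<And>x. 0 \<le> s x x \<and> s x x \<le> a * (norm x)\<^sup>2"
  shows "\<bar>s x y\<bar> \<le> a * norm x * norm y"
proof -
  have add': "s x (y + z) = s x y + s x z" for x y z by (metis sym add)
  have scale': "s x (r *\<^sub>R y) = r * s x y" for r x y by (metis sym scale)
  have diff: "s (x - y) z = s x z - s y z" and diff': "s z (x - y) = s z x - s z y" for x y z
    using add[of "x - y" y z] add'[of z "x - y" y] by simp_all
  have unit: "\<bar>s x y\<bar> \<le> a" if "norm x = 1" "norm y = 1" for x y
  proof -
    have "s (x + y) (x + y) - s (x - y) (x - y) = 4 * s x y"
      using sym[of x y] by (simp add: add add' diff diff')
    moreover have "a * (norm (x + y))\<^sup>2 + a * (norm (x - y))\<^sup>2 = 4 * a"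
    proof -
      have "(norm (x + y))\<^sup>2 + (norm (x - y))\<^sup>2 = 2 * (norm x)\<^sup>2 + 2 * (norm y)\<^sup>2"
        unfolding power2_norm_eq_inner by (simp add: inner_diff_left inner_diff_right inner_add_left inner_add_right)
      then show ?thesis using that by (simp flip: distrib_left)
    qed
    ultimately show ?thesis using bounds[of "x + y"] bounds[of "x - y"] by linarith
  qed
  show ?thesis
  proof (cases "x = 0 \<or> y = 0")
    case True
    then show ?thesis using scale[of 0 x y] scale'[of x 0 y] by auto
  next
    case False
    then have "\<bar>s (inverse (norm x) *\<^sub>R x) (inverse (norm y) *\<^sub>R y)\<bar> \<le> a"
      by (intro unit) auto
    then show ?thesis using False by (simp add: scale scale' abs_mult field_simps)
  qed
qed

text \<open>
  With \<open>A\<close> the operator representing \<open>s = inner - q / C\<close>, the form \<open>q\<close> is represented by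
  \<open>C * (1 - A)\<close>, and \<open>S\<close> is its square root \<open>sqrt C * (1 - B)\<close>. The operator \<open>B\<close> is sought among the
  self-adjoint complex-linear operators of norm at most \<open>r\<close>, a closed set on which
  \<open>B \<mapsto> (A + B\<^sup>2) / 2\<close> is a contraction with constant \<open>r\<close>. The radius \<open>r = 1 - sqrt (c / C)\<close> is the
  smaller fixed point of the scalar analogue \<open>b \<mapsto> (a + b\<^sup>2) / 2\<close>, so that the ball is mapped to itself.
\<close>

lemma form_factorization:
  fixes q :: "'h::complex_hilbert \<Rightarrow> 'h \<Rightarrow> real"
  assumes sym: "\<And>x y. q x y = q y x" and add: "\<And>x y z. q (x + y) z = q x z + q y z"
    and scale: "\<And>r x y. q (r *\<^sub>R x) y = r * q x y"
    and scaleC: "\<And>a x y. q (a *\<^sub>C x) y = q x (cnj a *\<^sub>C y)"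
    and c: "0 < c" "c \<le> C"
    and bounds: "\<And>x. c * (norm x)\<^sup>2 \<le> q x x \<and> q x x \<le> C * (norm x)\<^sup>2"
  shows "\<exists>S :: 'h \<Rightarrow> 'h. bounded_invertible S \<and> (\<forall>x y. inner (S x) (S y) = q x y)"
proof -
  have C: "C > 0" using c by simp
  define a where "a = 1 - c / C"
  define r where "r = 1 - sqrt (c / C)"
  have cC: "0 < c / C" "c / C \<le> 1" using c C by simp_all
  have r: "0 \<le> r" "r < 1" using cC by (simp_all add: r_def)
  have r_fix: "(a + r * r) / 2 = r"
  proof -
    have "(1 - w) * (1 - w) = 1 - 2 * w + w * w" for w :: real by (simp add: algebra_simps)
    moreover have "sqrt (c / C) * sqrt (c / C) = c / C"
      using cC by (simp only: real_sqrt_mult_self abs_of_pos)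
    ultimately have "r * r = 1 - 2 * sqrt (c / C) + c / C" by (simp only: r_def)
    then show ?thesis by (simp add: a_def r_def)
  qed
  define s where "s x y = inner x y - q x y / C" for x y
  have s_sym: "s x y = s y x" for x y by (simp add: s_def sym[of x y] inner_commute)
  have s_add: "s (x + y) z = s x z + s y z" for x y z
    by (simp add: s_def add inner_add_left add_divide_distrib)
  have s_scale: "s (t *\<^sub>R x) y = t * s x y" for t x y
    by (simp add: s_def scale right_diff_distrib)
  have s_add': "s z (x + y) = s z x + s z y" for x y z by (metis s_sym s_add)
  have s_scale': "s y (t *\<^sub>R x) = t * s y x" for t x y by (metis s_sym s_scale)
  have s_scaleC: "s (t *\<^sub>C x) y = s x (cnj t *\<^sub>C y)" for t x y
    by (simp add: s_def scaleC inner_scaleC_left)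
  have s_bounds: "0 \<le> s x x \<and> s x x \<le> a * (norm x)\<^sup>2" for x
    using bounds[of x] C by (simp add: s_def a_def field_simps flip: power2_norm_eq_inner)
  have s_le: "\<bar>s x y\<bar> \<le> a * norm x * norm y" for x y
    by (rule form_bound[OF s_sym s_add s_scale s_bounds])
  have "\<exists>z. \<forall>y. s x y = inner z y" for x
  proof (rule riesz_representation, rule bounded_linear_intro)
    show "norm (s x y) \<le> norm y * (a * norm x)" for y
      using s_le[of x y] by (simp add: algebra_simps)
  qed (simp_all add: s_add' s_scale')
  then obtain A0 where A0: "\<And>x y. inner (A0 x) y = s x y" by metis
  have eqI: "x = y" if "\<And>z. inner x z = inner y z" for x y :: 'h
  proof -
    have "inner (x - y) (x - y) = 0" using that[of "x - y"] by (simp only: inner_diff_left)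
    then show ?thesis by simp
  qed
  have A0_norm: "norm (A0 x) \<le> a * norm x" for x
  proof (cases "A0 x = 0")
    case True
    then show ?thesis using cC by (simp add: a_def)
  next
    case False
    have "norm (A0 x) * norm (A0 x) \<le> a * norm x * norm (A0 x)"
      using s_le[of x "A0 x"] A0[of x "A0 x"] by (simp add: power2_norm_eq_inner flip: power2_eq_square)
    then show ?thesis using False by simp
  qed
  have A0_lin: "bounded_linear A0"
  proof (rule bounded_linear_intro[of _ a])
    show "A0 (x + y) = A0 x + A0 y" for x y by (rule eqI) (simp add: A0 s_add inner_add_left)
    show "A0 (t *\<^sub>R x) = t *\<^sub>R A0 x" for t x by (rule eqI) (simp add: A0 s_scale)
    show "norm (A0 x) \<le> norm x * a" for x
      using A0_norm[of x] by (simp add: mult.commute)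
  qed
  define A where "A = Blinfun A0"
  have A: "blinfun_apply A x = A0 x" for x
    by (simp add: A_def bounded_linear_Blinfun_apply[OF A0_lin])
  have A_norm: "norm A \<le> a"
    by (rule norm_blinfun_bound) (use cC A0_norm in \<open>simp_all add: a_def A\<close>)
  have A_adj: "inner (A x) y = inner x (A y)" for x y
    by (metis A A0 inner_commute s_sym)
  have A_C: "A (t *\<^sub>C x) = t *\<^sub>C A x" for t x
    by (rule eqI) (simp add: A A0 s_scaleC inner_scaleC_left)
  define K where "K = {B. norm B \<le> r} \<inter> {B :: 'h \<Rightarrow>\<^sub>L 'h. \<forall>x y. inner (B x) y = inner x (B y)} \<inter>
    {B :: 'h \<Rightarrow>\<^sub>L 'h. \<forall>t x. B (t *\<^sub>C x) = t *\<^sub>C B x}"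
  define \<Phi> where "\<Phi> B = (1 / 2) *\<^sub>R (A + (B o\<^sub>L B))" for B :: "'h \<Rightarrow>\<^sub>L 'h"
  have "\<exists>!B\<in>K. \<Phi> B = B"
  proof (rule Banach_fix[OF _ _ r])
    have scaleC_cont: "continuous_on UNIV (\<lambda>B :: 'h \<Rightarrow>\<^sub>L 'h. t *\<^sub>C B x)" for t x
      by (intro bounded_linear.continuous_on[OF bounded_linear_scaleC] continuous_intros)
    have "closed K"
      unfolding K_def
      by (intro closed_Int closed_Collect_all closed_Collect_eq closed_Collect_le continuous_intros scaleC_cont)
    then show "complete K" by (simp add: complete_eq_closed)
    have "0 \<in> K"
      using r by (simp add: K_def linear_simps(3)[OF bounded_linear_scaleC])
    then show "K \<noteq> {}" by blast
    show "\<Phi> ` K \<subseteq> K"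
    proof
      fix D assume "D \<in> \<Phi> ` K"
      then obtain B :: "'h \<Rightarrow>\<^sub>L 'h" where B: "norm B \<le> r" "\<And>x y. inner (B x) y = inner x (B y)"
          "\<And>t x. B (t *\<^sub>C x) = t *\<^sub>C B x" and D: "D = \<Phi> B"
        by (auto simp: K_def)
      have D_apply: "D x = (1 / 2) *\<^sub>R (A x + B (B x))" for x
        by (simp add: D \<Phi>_def blinfun.add_left blinfun.scaleR_left)
      have "norm (B o\<^sub>L B) \<le> r * r"
        using norm_blinfun_compose[of B B] mult_mono[OF B(1) B(1)] r by (simp add: order_trans)
      then have "norm D \<le> (a + r * r) / 2"
        using norm_triangle_ineq[of A "B o\<^sub>L B"] A_norm by (simp add: D \<Phi>_def)
      moreover have "inner (D x) y = inner x (D y)" for x y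
        by (simp add: D_apply inner_add_left inner_add_right A_adj B(2))
      moreover have "D (t *\<^sub>C x) = t *\<^sub>C D x" for t x
        using linear_simps(5)[OF bounded_linear_scaleC, of t "1/2" "A x + B (B x)"]
        by (simp add: D_apply A_C B(3) scaleC_add_right)
      ultimately show "D \<in> K" by (simp add: K_def r_fix)
    qed
    fix B D assume "B \<in> K" "D \<in> K"
    then have BD: "norm B \<le> r" "norm D \<le> r" by (auto simp: K_def)
    have "\<Phi> B - \<Phi> D = (1 / 2) *\<^sub>R ((B o\<^sub>L (B - D)) + ((B - D) o\<^sub>L D))"
      by (rule blinfun_eqI) (simp add: \<Phi>_def blinfun.bilinear_simps algebra_simps)
    moreover have "norm (B o\<^sub>L (B - D)) \<le> r * norm (B - D)"
      using norm_blinfun_compose[of B "B - D"] mult_right_mono[OF BD(1), of "norm (B - D)"] by simp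
    moreover have "norm ((B - D) o\<^sub>L D) \<le> r * norm (B - D)"
      using norm_blinfun_compose[of "B - D" D] mult_left_mono[OF BD(2), of "norm (B - D)"] by (simp add: mult.commute)
    ultimately show "dist (\<Phi> B) (\<Phi> D) \<le> r * dist B D"
      using norm_triangle_ineq[of "B o\<^sub>L (B - D)" "(B - D) o\<^sub>L D"] by (simp add: dist_norm)
  qed
  then obtain B where B: "B \<in> K" "\<Phi> B = B" by blast
  have B_norm: "norm B \<le> r" and B_adj: "\<And>x y. inner (B x) y = inner x (B y)"
    and B_C: "\<And>t x. B (t *\<^sub>C x) = t *\<^sub>C B x"
    using B(1) by (auto simp: K_def)
  have B_square: "B (B x) = 2 *\<^sub>R B x - A x" for x
  proof -
    have "2 *\<^sub>R blinfun_apply (\<Phi> B) x = A x + B (B x)"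
      by (simp add: \<Phi>_def blinfun.add_left blinfun.scaleR_left)
    then have "2 *\<^sub>R B x = A x + B (B x)" by (simp only: B(2))
    then show ?thesis by simp
  qed
  define S where "S x = sqrt C *\<^sub>R (x - B x)" for x
  have S_form: "inner (S x) (S y) = q x y" for x y
  proof -
    have "inner (S x) (S y) = C * inner (x - B x) (y - B y)"
      using C by (simp add: S_def)
    also have "inner (x - B x) (y - B y) = inner (x - 2 *\<^sub>R B x + B (B x)) y"
      using B_adj[of x y] B_adj[of "B x" y]
      by (simp add: inner_diff_left inner_diff_right inner_add_left)
    also have "\<dots> = inner x y - s x y"
      by (simp add: B_square inner_diff_left A A0)
    finally show ?thesis using C by (simp add: s_def)
  qed
  have "bounded_invertible S"
  proof (rule bounded_invertibleI)
    have "bounded_linear S"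
      unfolding S_def by (intro bounded_linear_intros blinfun.bounded_linear_right)
    moreover have "S (t *\<^sub>C x) = t *\<^sub>C S x" for t x
      using linear_simps(2)[OF bounded_linear_scaleC, of t x "B x"]
        linear_simps(5)[OF bounded_linear_scaleC, of t "sqrt C" "x - B x"]
      by (simp only: S_def B_C)
    ultimately show "bounded_clinear S" by (simp add: bounded_clinear_def)
    \<comment> \<open>As \<open>B\<close> is itself a contraction, \<open>x - B x = y / sqrt C\<close> is solved by a fixed point.\<close>
    show "surj S"
      unfolding surj_def
    proof
      fix y
      have "\<exists>!x. y /\<^sub>R sqrt C + B x = x"
      proof (rule banach_fix_type[OF r], intro allI)
        fix u v
        have "norm (B (u - v)) \<le> norm B * norm (u - v)" by (rule norm_blinfun)
        also have "\<dots> \<le> r * norm (u - v)" using B_norm by (simp add: mult_right_mono)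
        finally show "dist (y /\<^sub>R sqrt C + B u) (y /\<^sub>R sqrt C + B v) \<le> r * dist u v"
          by (simp add: dist_norm blinfun.diff_right)
      qed
      then obtain x where x: "y /\<^sub>R sqrt C + B x = x" by blast
      have "x - B x = y /\<^sub>R sqrt C" by (simp only: diff_eq_eq x)
      then show "\<exists>x. y = S x" using C by (intro exI[of _ x]) (simp add: S_def)
    qed
    show "sqrt c > 0" using c by simp
    show "sqrt c * norm x \<le> norm (S x)" for x
    proof (rule power2_le_imp_le)
      show "(sqrt c * norm x)\<^sup>2 \<le> (norm (S x))\<^sup>2"
        using bounds[of x] c S_form[of x x] by (simp add: power_mult_distrib power2_norm_eq_inner)
    qed simp
  qed
  then show ?thesis using S_form by blast
qed

section \<open>Unitarizing the representation\<close>

text \<open>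
  The form is the mean of \<open>inner (\<Gamma> u x) (\<Gamma> u y)\<close> over the group. If \<open>M\<close> bounds all norms \<open>\<parallel>\<Gamma> u\<parallel>\<close>, then
  \<open>1 / M\<close> is a lower bound for \<open>\<parallel>\<Gamma> u x\<parallel> / \<parallel>x\<parallel>\<close> since the inverse of \<open>\<Gamma> u\<close> is again a value of \<open>\<Gamma>\<close>.
\<close>

lemma invariant_form:
  fixes \<Gamma> :: "complex^'d::finite^'d \<Rightarrow> 'h::complex_hilbert \<Rightarrow> 'h"
  assumes rep: "strongly_continuous_rep \<Gamma>"
  shows "\<exists>S :: 'h \<Rightarrow> 'h. bounded_invertible S \<and>
    (\<forall>u\<in>unitary_group. \<forall>x y. inner (S (\<Gamma> u x)) (S (\<Gamma> u y)) = inner (S x) (S y))"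
proof -
  have lin: "bounded_linear (\<Gamma> u)" and C_lin: "\<And>a x. \<Gamma> u (a *\<^sub>C x) = a *\<^sub>C \<Gamma> u x"
    if "u \<in> unitary_group" for u
    using rep that by (auto simp: strongly_continuous_rep_def bounded_invertible_def bounded_clinear_def)
  have mult: "\<Gamma> (u ** v) x = \<Gamma> u (\<Gamma> v x)" if "u \<in> unitary_group" "v \<in> unitary_group" for u v x
    using rep that by (simp add: strongly_continuous_rep_def)
  have cont: "continuous_on unitary_group (\<lambda>u. \<Gamma> u x)" for x
    using rep by (simp add: strongly_continuous_rep_def)
  have one: "\<Gamma> (mat 1) x = x" for x
  proof -
    obtain B where "B \<circ> \<Gamma> (mat 1) = id"
      using rep mat_1_unitary unfolding strongly_continuous_rep_def bounded_invertible_def by blast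
    then show ?thesis using mult[OF mat_1_unitary mat_1_unitary, of x] by (metis comp_apply id_apply matrix_mul_lid)
  qed
  have bdd: "bounded ((\<lambda>u. \<Gamma> u x) ` unitary_group)" for x
    by (intro compact_imp_bounded compact_continuous_image cont compact_unitary_group)
  obtain M0 where M0: "M0 > 0" "\<And>u x. u \<in> unitary_group \<Longrightarrow> norm (\<Gamma> u x) \<le> M0 * norm x"
    using uniform_boundedness[of unitary_group \<Gamma>, OF lin bdd] by blast
  \<comment> \<open>With \<open>M \<ge> 1\<close> the two bounds on the form satisfy \<open>(1 / M)\<^sup>2 \<le> M\<^sup>2\<close>, even if the space is trivial.\<close>
  define M where "M = max M0 1"
  have M: "M \<ge> 1" by (simp add: M_def)
  have upper: "norm (\<Gamma> u x) \<le> M * norm x" if "u \<in> unitary_group" for u x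
    using M0(2)[OF that, of x] mult_right_mono[of M0 M "norm x"] by (simp add: M_def)
  have lower: "norm x \<le> M * norm (\<Gamma> u x)" if u: "u \<in> unitary_group" for u x
  proof -
    have "\<Gamma> (ctranspose u) (\<Gamma> u x) = x"
      using mult[OF ctranspose_unitary[OF u] u, of x] u one by (simp add: unitary_group_def)
    then show ?thesis using upper[OF ctranspose_unitary[OF u], of "\<Gamma> u x"] by simp
  qed
  define q where "q x y = unitary.mean (\<lambda>u. inner (\<Gamma> u x) (\<Gamma> u y))" for x y
  have uc: "uniformly_continuous_on unitary_group (\<lambda>u. inner (\<Gamma> u x) (\<Gamma> u y))" for x y
    by (intro compact_uniformly_continuous continuous_intros cont compact_unitary_group)
  have "\<exists>S :: 'h \<Rightarrow> 'h. bounded_invertible S \<and> (\<forall>x y. inner (S x) (S y) = q x y)"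
  proof (rule form_factorization)
    show "q x y = q y x" for x y by (simp add: q_def inner_commute)
    show "q (x + y) z = q x z + q y z" for x y z
      unfolding q_def unitary.mean_add[OF uc uc, symmetric]
      using lin by (intro unitary.mean_cong) (simp add: linear_simps inner_add_left)
    show "q (r *\<^sub>R x) y = r * q x y" for r x y
      unfolding q_def unitary.mean_scale[OF uc, symmetric]
      using lin by (intro unitary.mean_cong) (simp add: linear_simps)
    show "q (a *\<^sub>C x) y = q x (cnj a *\<^sub>C y)" for a x y
      unfolding q_def by (intro unitary.mean_cong) (simp add: C_lin inner_scaleC_left)
    have "(1 / M * norm x)\<^sup>2 \<le> inner (\<Gamma> u x) (\<Gamma> u x) \<and> inner (\<Gamma> u x) (\<Gamma> u x) \<le> (M * norm x)\<^sup>2"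
      if "u \<in> unitary_group" for u x
      unfolding power2_norm_eq_inner[symmetric]
      using upper[OF that, of x] lower[OF that, of x] M by (intro conjI power_mono) (simp_all add: field_simps)
    from unitary.mean_bounds[OF uc this]
    show "(1 / M)\<^sup>2 * (norm x)\<^sup>2 \<le> q x x \<and> q x x \<le> M\<^sup>2 * (norm x)\<^sup>2" for x
      by (simp add: q_def power_mult_distrib power_divide)
    show "0 < (1 / M)\<^sup>2" using M by simp
    show "(1 / M)\<^sup>2 \<le> M\<^sup>2" using M by (intro power_mono) (simp_all add: field_simps mult_ge1_I)
  qed
  then obtain S :: "'h \<Rightarrow> 'h" where S: "bounded_invertible S" "\<And>x y. inner (S x) (S y) = q x y" by blast
  have "q (\<Gamma> v x) (\<Gamma> v y) = q x y" if v: "v \<in> unitary_group" for v x y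
  proof -
    have "q (\<Gamma> v x) (\<Gamma> v y) = unitary.mean (\<lambda>u. inner (\<Gamma> (u ** v) x) (\<Gamma> (u ** v) y))"
      unfolding q_def by (rule unitary.mean_cong) (simp add: mult v)
    also have "\<dots> = q x y"
      unfolding q_def by (rule unitary.mean_right_translate[OF uc v])
    finally show ?thesis .
  qed
  then show ?thesis using S by (intro exI[of _ S]) simp
qed

theorem proposition2p1:
  fixes T :: "'d::finite \<Rightarrow> 'h::complex_hilbert \<Rightarrow> 'h"
    and \<Gamma> :: "complex^'d^'d \<Rightarrow> 'h \<Rightarrow> 'h"
  assumes separable: "\<exists>D :: 'h set. countable D \<and> closure D = UNIV"
    and "commuting_tuple T"
    and "weakly_homogeneous T"
    and "\<And>u. u \<in> unitary_group \<Longrightarrow> bounded_invertible (\<Gamma> u)"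
    and "\<And>u j. u \<in> unitary_group \<Longrightarrow> \<Gamma> u \<circ> T j = act_tuple u T j \<circ> \<Gamma> u"
    and "strongly_continuous_rep \<Gamma>"
  shows "\<exists>T' :: 'd \<Rightarrow> 'h \<Rightarrow> 'h. homogeneous T' \<and> similar_tuples T T'"
proof -
  obtain S :: "'h \<Rightarrow> 'h" where S: "bounded_invertible S"
    and S_inv: "\<And>u x y. u \<in> unitary_group \<Longrightarrow> inner (S (\<Gamma> u x)) (S (\<Gamma> u y)) = inner (S x) (S y)"
    using invariant_form[OF assms(6)] by blast
  obtain R where S_lin: "bounded_clinear S" and R_lin: "bounded_clinear R"
    and RS: "\<And>x. R (S x) = x" and SR: "\<And>x. S (R x) = x"
    using S unfolding bounded_invertible_def by (metis comp_apply id_apply)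
  have T_lin: "bounded_clinear (T j)" and T_comm: "T i (T j x) = T j (T i x)" for i j x
    using assms(2) by (auto simp: commuting_tuple_def fun_eq_iff)
  define T' where "T' j = S \<circ> T j \<circ> R" for j
  have "commuting_tuple T'"
    using S_lin R_lin T_lin T_comm
    by (auto simp: commuting_tuple_def T'_def RS fun_eq_iff intro!: bounded_clinear_compose)
  moreover have "unitarily_equivalent T' (act_tuple u T')" if u: "u \<in> unitary_group" for u
  proof -
    obtain \<Gamma>' where \<Gamma>_lin: "bounded_clinear (\<Gamma> u)" and \<Gamma>': "\<And>x. \<Gamma> u (\<Gamma>' x) = x"
      using assms(4)[OF u] unfolding bounded_invertible_def by (metis comp_apply id_apply)
    define V where "V = S \<circ> \<Gamma> u \<circ> R"
    have V_lin: "bounded_clinear V"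
      unfolding V_def by (intro bounded_clinear_compose S_lin \<Gamma>_lin R_lin)
    have V_inner: "inner (V x) (V y) = inner x y" for x y
      by (simp add: V_def S_inv[OF u] SR)
    have "cinner (V x) (V y) = cinner x y" for x y
      using V_lin V_inner[of x "\<i> *\<^sub>C y"] by (simp add: cinner_eq_inner V_inner bounded_clinear_def)
    moreover have "surj V"
      by (rule surjI[of _ "S \<circ> \<Gamma>' \<circ> R"]) (simp add: V_def RS SR \<Gamma>')
    ultimately have "unitary_op V"
      using V_lin by (simp add: unitary_op_def)
    moreover have "V (T' j x) = act_tuple u T' j (V x)" for j x
    proof -
      have "V (T' j x) = S (act_tuple u T j (\<Gamma> u (R x)))"
        using fun_cong[OF assms(5)[OF u, of j], of "R x"] by (simp add: V_def T'_def RS)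
      also have "\<dots> = act_tuple u T' j (V x)"
        by (simp add: act_tuple_def bounded_clinear_sum[OF S_lin] V_def T'_def RS)
      finally show ?thesis .
    qed
    ultimately show ?thesis
      unfolding unitarily_equivalent_def by (intro exI[of _ V]) (simp add: fun_eq_iff)
  qed
  moreover have "similar_tuples T T'"
    unfolding similar_tuples_def using S by (intro exI[of _ S]) (simp add: fun_eq_iff T'_def RS)
  ultimately show ?thesis unfolding homogeneous_def by blast
qed

end
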